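(* There exists a set $\mathcal{A}\subset\mathbb{R}$ of full Lebesgue measure (i.e. whose complement has Lebesgue measure zero) such that for any $\alpha\in\mathcal{A}$, any $\gamma\in\mathbb{R}$ and any $c>0$ there is a constant $C=C(\alpha,\gamma,c)>0$ such that for all sufficiently large $N\in\mathbb{N}$ $$\sum_{\substack{1\le n\le N\\ n\|n\alpha-\gamma\|\ge c}}\frac{1}{n\|n\alpha-\gamma\|}\ \le\ C(\log N)^2.$$
   Context: $\|x\|$ denotes the distance from $x\in\mathbb{R}$ to the nearest integer. *)

theory Defs
  imports "HOL-Analysis.Analysis"
begin

definition dist_int :: "real \<Rightarrow> real" where
  "dist_int x = infdist x \<int>"

end

theory Submission
  imports Defs
begin

text \<open>
  Cut the sum into dyadic blocks \<open>2\<^sup>j \<le> n < 2\<^sup>j\<^sup>+\<^sup>1\<close>, and each block into layers according to the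
  least \<open>i\<close> with \<open>\<parallel>n\<alpha> - \<gamma>\<parallel> \<le> 2\<^sup>i/2\<^sup>j\<close>. A term in layer \<open>i \<ge> 1\<close> is at most \<open>2 / 2\<^sup>i\<close>, and a term in layer \<open>0\<close>
  is at most \<open>1/c\<close> because of the cutoff. One expects about \<open>2\<^sup>i\<close> members of layer \<open>i\<close>, so that each of
  the \<open>j + 1\<close> layers contributes \<open>O(1)\<close>, the block contributes \<open>O(j + 1)\<close>, and the blocks with
  \<open>2\<^sup>j \<le> N\<close> together contribute \<open>O((log N)\<^sup>2)\<close>. What has to be shown is that the layers are not much
  fuller than expected, for almost every \<open>\<alpha>\<close> and all \<open>\<gamma>\<close> at once.

  Uniformity in \<open>\<gamma>\<close> comes from rational approximation. If \<open>\<bar>q\<alpha> - p\<bar> \<le> 1/q\<close> with \<open>p, q\<close> coprime, then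
  among \<open>q\<close> consecutive \<open>n\<close> the points \<open>n\<alpha>\<close> are, up to an error \<open>1/q\<close>, a translate of the
  fractions with denominator \<open>q\<close>; hence among \<open>N\<close> consecutive \<open>n\<close> at most \<open>(N/q + 1)(2q\<delta> + 3)\<close> satisfy \<open>\<parallel>n\<alpha> - \<gamma>\<parallel> \<le> \<delta>\<close>
  (\<open>card_near_le\<close>). The excess over \<open>2N\<delta>\<close> is \<open>O(N/q + q\<delta> + 1)\<close>. Dirichlet's theorem supplies a \<open>q\<close> for
  which this is \<open>O(M + 1)\<close>, unless \<open>\<alpha>\<close> has an approximation with denominator \<open>q < N/M\<close> and the very
  small error \<open>\<bar>q\<alpha> - p\<bar> < \<delta>/M\<close>. Such \<open>\<alpha>\<close> have density \<open>O(N\<delta>/M\<^sup>2)\<close> (\<open>measure_too_approximable_le\<close>).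

  In layer \<open>i\<close> of block \<open>j\<close> we have \<open>N\<delta> = 2\<^sup>i\<close>, and \<open>M = (j + 1) (3/2)\<^sup>i\<close> meets both demands:
  \<open>\<Sum>\<^sub>i 2\<^sup>i/M\<^sup>2 = O((j + 1)\<^sup>-\<^sup>2)\<close> is summable over \<open>j\<close>, so by the Borel-Cantelli lemma almost every \<open>\<alpha>\<close>
  is exceptional for only finitely many blocks; and \<open>\<Sum>\<^sub>i M/2\<^sup>i = O(j + 1)\<close>, so the excess costs a
  block no more than its main term.
\<close>

section \<open>Distance to the nearest integer\<close>

lemma dist_int_attained:
  obtains z :: int where "dist_int x = \<bar>x - of_int z\<bar>"
proof -
  obtain y where "y \<in> (\<int> :: real set)" "infdist x \<int> = dist x y"
    by (rule infdist_attains_inf[of "\<int> :: real set" x]) (use Ints_0 closed_Ints in \<open>blast+\<close>)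
  then show thesis
    by (metis Ints_cases that dist_int_def dist_real_def)
qed

lemma dist_int_le_half: "dist_int x \<le> 1 / 2"
proof -
  have "dist_int x \<le> dist x (of_int (round x))"
    unfolding dist_int_def by (rule infdist_le) auto
  also have "\<dots> \<le> 1 / 2"
    using of_int_round_abs_le[of x] by (simp add: dist_real_def abs_minus_commute)
  finally show ?thesis .
qed

section \<open>Counting multiples near a point of the circle\<close>

lemma card_ints_in_interval_le:
  fixes x r :: real
  assumes "r \<ge> 0"
  shows "finite {t :: int. \<bar>of_int t - x\<bar> \<le> r}"
    and "real (card {t :: int. \<bar>of_int t - x\<bar> \<le> r}) \<le> 2 * r + 1"
proof -
  have eq: "{t :: int. \<bar>of_int t - x\<bar> \<le> r} = {\<lceil>x - r\<rceil>..\<lfloor>x + r\<rfloor>}"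
    by (auto simp: abs_le_iff ceiling_le_iff le_floor_iff)
  show "finite {t :: int. \<bar>of_int t - x\<bar> \<le> r}"
    unfolding eq by simp
  show "real (card {t :: int. \<bar>of_int t - x\<bar> \<le> r}) \<le> 2 * r + 1"
    unfolding eq using assms by simp linarith
qed

text \<open>
  Write \<open>n = b + r\<close> with \<open>0 \<le> r < q\<close>. Since \<open>\<alpha>\<close> is within \<open>1/q\<^sup>2\<close> of \<open>p/q\<close>, replacing \<open>r\<alpha>\<close> by \<open>rp/q\<close>
  costs at most \<open>1/q\<close>. After scaling by \<open>q\<close>, each \<open>n\<close> counted here yields an integer congruent to
  \<open>rp\<close> modulo \<open>q\<close> in one fixed interval of radius \<open>q\<delta> + 1\<close>, and distinct \<open>n\<close> yield distinct
  integers because \<open>p\<close> is invertible modulo \<open>q\<close>.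
\<close>
lemma card_near_full_period_le:
  fixes q p :: int and \<alpha> \<gamma> \<delta> :: real
  assumes "q > 0" "coprime p q" "\<bar>of_int q * \<alpha> - of_int p\<bar> \<le> 1 / of_int q" "\<delta> \<ge> 0"
  shows "real (card {n \<in> {b..<b + nat q}. dist_int (real n * \<alpha> - \<gamma>) \<le> \<delta>})
         \<le> 2 * of_int q * \<delta> + 3"
proof -
  let ?S = "{n \<in> {b..<b + nat q}. dist_int (real n * \<alpha> - \<gamma>) \<le> \<delta>}"
  let ?x = "of_int q * (\<gamma> - real b * \<alpha>)"
  let ?T = "{t :: int. \<bar>of_int t - ?x\<bar> \<le> of_int q * \<delta> + 1}"
  have "\<exists>z :: int. dist_int (real n * \<alpha> - \<gamma>) = \<bar>real n * \<alpha> - \<gamma> - of_int z\<bar>" for n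
    by (rule dist_int_attained[of "real n * \<alpha> - \<gamma>"]) blast
  then obtain z :: "nat \<Rightarrow> int"
    where z: "\<And>n. dist_int (real n * \<alpha> - \<gamma>) = \<bar>real n * \<alpha> - \<gamma> - of_int (z n)\<bar>"
    by metis
  define f where "f n = (int n - int b) * p - q * z n" for n
  have inj: "inj_on f ?S"
  proof (rule inj_onI)
    fix m n assume mn: "m \<in> ?S" "n \<in> ?S" "f m = f n"
    then have "(int m - int n) * p = q * (z m - z n)"
      by (simp add: f_def algebra_simps)
    then have "q dvd (int m - int n) * p" by simp
    then have "q dvd int m - int n"
      using assms(2) by (simp add: coprime_dvd_mult_left_iff coprime_commute)
    moreover have "\<bar>int m - int n\<bar> < q"
      using mn assms(1) by auto
    ultimately show "m = n"
      using dvd_imp_le_int[of "int m - int n" q] assms(1) by linarith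
  qed
  have "f ` ?S \<subseteq> ?T"
  proof clarify
    fix n assume n: "n \<in> {b..<b + nat q}" "dist_int (real n * \<alpha> - \<gamma>) \<le> \<delta>"
    define r where "r = real n - real b"
    have r: "0 \<le> r" "r \<le> of_int q"
      using n(1) assms(1) by (auto simp: r_def)
    have "of_int (f n) - ?x
        = of_int q * (real n * \<alpha> - \<gamma> - of_int (z n)) - r * (of_int q * \<alpha> - of_int p)"
      by (simp add: f_def r_def algebra_simps)
    moreover have "\<bar>of_int q * (real n * \<alpha> - \<gamma> - of_int (z n))\<bar> \<le> of_int q * \<delta>"
      using n(2) assms(1) by (simp add: z abs_mult)
    moreover have "\<bar>r * (of_int q * \<alpha> - of_int p)\<bar> \<le> of_int q * (1 / of_int q)"
      unfolding abs_mult using r assms(3) by (intro mult_mono) auto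
    ultimately show "\<bar>of_int (f n) - ?x\<bar> \<le> of_int q * \<delta> + 1"
      using assms(1) by simp
  qed
  moreover have r0: "of_int q * \<delta> + 1 \<ge> 0"
    using assms by simp
  ultimately have "card ?S \<le> card ?T"
    using card_inj_on_le[OF inj] card_ints_in_interval_le(1)[OF r0] by blast
  then show ?thesis
    using card_ints_in_interval_le(2)[OF r0, of ?x] by simp
qed

text \<open>
  A block of length \<open>N\<close> is covered by \<open>N div q + 1\<close> periods of length \<open>q\<close>; the rounding up is harmless
  since the bound for one period does not depend on its position.
\<close>
lemma card_near_le:
  fixes q p :: int and \<alpha> \<gamma> \<delta> :: real
  assumes "q > 0" "coprime p q" "\<bar>of_int q * \<alpha> - of_int p\<bar> \<le> 1 / of_int q" "\<delta> \<ge> 0"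
  shows "real (card {n \<in> {b..<b + N}. dist_int (real n * \<alpha> - \<gamma>) \<le> \<delta>})
         \<le> (real N / of_int q + 1) * (2 * of_int q * \<delta> + 3)"
proof -
  let ?near = "\<lambda>n. dist_int (real n * \<alpha> - \<gamma>) \<le> \<delta>"
  define s where "s = nat q"
  have s: "s > 0" "real s = of_int q" using assms(1) by (auto simp: s_def)
  let ?blk = "\<lambda>t. {n \<in> {b + t * s..<b + t * s + s}. ?near n}"
  have "{n \<in> {b..<b + N}. ?near n} \<subseteq> (\<Union>t\<in>{..N div s}. ?blk t)"
  proof clarify
    fix n assume n: "n \<in> {b..<b + N}" "?near n"
    define t where "t = (n - b) div s"
    have "t \<le> N div s"
      unfolding t_def using n by (intro div_le_mono) auto
    moreover have "t * s \<le> n - b" "n - b < t * s + s"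
      unfolding t_def using s(1) by (simp_all add: dividend_less_div_times add.commute)
    ultimately show "n \<in> (\<Union>t\<in>{..N div s}. ?blk t)"
      using n by (intro UN_I[of t]) auto
  qed
  then have "card {n \<in> {b..<b + N}. ?near n} \<le> card (\<Union>t\<in>{..N div s}. ?blk t)"
    by (intro card_mono) auto
  also have "\<dots> \<le> (\<Sum>t\<le>N div s. card (?blk t))"
    by (intro card_UN_le) auto
  finally have "real (card {n \<in> {b..<b + N}. ?near n}) \<le> (\<Sum>t\<le>N div s. real (card (?blk t)))"
    by (simp flip: of_nat_sum)
  also have "\<dots> \<le> (\<Sum>t\<le>N div s. 2 * of_int q * \<delta> + 3)"
    unfolding s_def by (intro sum_mono card_near_full_period_le[OF assms])
  also have "\<dots> = (real (N div s) + 1) * (2 * of_int q * \<delta> + 3)"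
    by simp
  also have "\<dots> \<le> (real N / of_int q + 1) * (2 * of_int q * \<delta> + 3)"
  proof (intro mult_right_mono add_right_mono)
    show "real (N div s) \<le> real N / of_int q"
      using of_nat_div_le_of_nat[of N s, where 'a=real] s(2) by simp
  qed (use assms in auto)
  finally show ?thesis .
qed

text \<open>
  For \<open>\<alpha>\<close> in this set Dirichlet's theorem with the bound \<open>M/\<delta>\<close> on the denominator may return a
  denominator below \<open>N/M\<close>, too small for the points \<open>n\<alpha>\<close> to spread out.
\<close>
definition too_approximable :: "real \<Rightarrow> real \<Rightarrow> real \<Rightarrow> real set" where
  "too_approximable N \<delta> M = {\<alpha>. \<exists>q p :: int. 1 \<le> q \<and> of_int q * M < N \<and>
      \<bar>of_int q * \<alpha> - of_int p\<bar> * M < \<delta>}"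

text \<open>
  Dirichlet's theorem gives \<open>q \<le> \<lceil>M/\<delta>\<rceil>\<close>, which bounds \<open>q\<delta>\<close> by \<open>2M\<close>; the hypothesis on \<open>\<alpha>\<close> forces
  \<open>q \<ge> N/M\<close>, which bounds \<open>N/q\<close> by \<open>M\<close>. These are the two excess terms of \<open>card_near_le\<close>.
\<close>
lemma card_near_le_if_not_too_approximable:
  assumes "\<alpha> \<notin> too_approximable (real N) \<delta> M" "0 < \<delta>" "\<delta> \<le> M"
  shows "real (card {n \<in> {b..<b + N}. dist_int (real n * \<alpha> - \<gamma>) \<le> \<delta>})
         \<le> 2 * real N * \<delta> + 7 * M + 3"
proof -
  define Q where "Q = nat \<lceil>M / \<delta>\<rceil>"
  have MQ: "M / \<delta> \<ge> 1" using assms by simp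
  have Q: "Q > 0" "real Q \<ge> M / \<delta>" "real Q \<le> 2 * (M / \<delta>)"
    unfolding Q_def using MQ by linarith+
  obtain p q where pq: "coprime p q" "0 < q" "q \<le> int Q"
      "\<bar>of_int q * \<alpha> - of_int p\<bar> < 1 / real Q"
    using Dirichlet_approx_coprime[OF Q(1), of \<alpha>] by metis
  have qQ: "real_of_int q \<le> real Q" using pq(3) by linarith
  have "\<bar>of_int q * \<alpha> - of_int p\<bar> * M < \<delta>"
  proof -
    have "\<bar>of_int q * \<alpha> - of_int p\<bar> * M < 1 / real Q * M"
      using pq(4) assms by (intro mult_strict_right_mono) auto
    also have "\<dots> \<le> \<delta>"
      using Q(1,2) assms by (simp add: field_simps)
    finally show ?thesis .
  qed
  moreover have "1 \<le> q" using pq(2) by simp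
  ultimately have qM: "real N \<le> of_int q * M"
    using assms(1) unfolding too_approximable_def mem_Collect_eq not_ex by (meson not_le)
  have "1 / real Q \<le> 1 / of_int q"
    using qQ pq(2) by (intro divide_left_mono) auto
  then have "real (card {n \<in> {b..<b + N}. dist_int (real n * \<alpha> - \<gamma>) \<le> \<delta>})
         \<le> (real N / of_int q + 1) * (2 * of_int q * \<delta> + 3)"
    using pq assms by (intro card_near_le[of q p]) auto
  also have "\<dots> = 2 * real N * \<delta> + 3 * (real N / of_int q) + 2 * (of_int q * \<delta>) + 3"
    using pq(2) by (simp add: field_simps)
  also have "\<dots> \<le> 2 * real N * \<delta> + 3 * M + 2 * (2 * M) + 3"
  proof -
    have "real N / of_int q \<le> M" using qM pq(2) by (simp add: field_simps)
    moreover have "of_int q * \<delta> \<le> 2 * (M / \<delta>) * \<delta>"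
      using qQ Q(3) assms by (intro mult_right_mono) auto
    ultimately show ?thesis using assms by simp
  qed
  finally show ?thesis by simp
qed

section \<open>Almost every number is rarely too approximable\<close>

lemma open_too_approximable: "open (too_approximable N \<delta> M)"
  unfolding too_approximable_def
  by (intro open_Collect_ex open_Collect_conj open_Collect_const open_Collect_less continuous_intros)

text \<open>
  The square of \<open>M\<close> is what makes the argument work: one factor comes from the number \<open>N/M\<close> of
  denominators, the other from the width \<open>\<delta>/M\<close>. For each denominator \<open>q\<close> the \<open>q + 1\<close> fractions in the
  unit interval carry intervals of length \<open>2\<delta>/(Mq)\<close>, of total length at most \<open>4\<delta>/M\<close>.
\<close>
lemma measure_too_approximable_le:
  fixes k :: int
  assumes "0 < \<delta>" "\<delta> \<le> M" "0 \<le> N"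
  shows "measure lborel (too_approximable N \<delta> M \<inter> {of_int k..of_int k + 1}) \<le> 4 * N * \<delta> / M\<^sup>2"
proof -
  define I where "I q p = {(of_int p - \<delta> / M) / of_int q..(of_int p + \<delta> / M) / of_int q}" for q p :: int
  let ?Q = "{1..\<lfloor>N / M\<rfloor>}"
  let ?P = "\<lambda>q. {k * q..k * q + q}"
  have M: "M > 0" using assms by simp
  have cover: "too_approximable N \<delta> M \<inter> {of_int k..of_int k + 1} \<subseteq> (\<Union>q\<in>?Q. \<Union>p\<in>?P q. I q p)"
  proof
    fix \<alpha> assume "\<alpha> \<in> too_approximable N \<delta> M \<inter> {of_int k..of_int k + 1}"
    then obtain q p :: int where qp: "1 \<le> q" "of_int q * M < N"
        "\<bar>of_int q * \<alpha> - of_int p\<bar> * M < \<delta>" "of_int k \<le> \<alpha>" "\<alpha> \<le> of_int k + 1"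
      by (auto simp: too_approximable_def)
    have d: "\<bar>of_int q * \<alpha> - of_int p\<bar> < \<delta> / M"
      using qp(3) M by (simp add: field_simps)
    have d1: "\<bar>of_int q * \<alpha> - of_int p\<bar> < 1"
      using d assms M by (simp add: divide_le_eq_1) (smt (verit) divide_le_eq_1_pos)
    have "of_int q * of_int k \<le> of_int q * \<alpha>" "of_int q * \<alpha> \<le> of_int q * (of_int k + 1)"
      using qp by (auto intro!: mult_left_mono)
    \<comment> \<open>An error below \<open>1\<close> keeps \<open>p/q\<close> itself in the closed unit interval that contains \<open>\<alpha>\<close>.\<close>
    then have "real_of_int (k * q) < of_int (p + 1)" "real_of_int p < of_int (k * q + q + 1)"
      using d1 by (auto simp: algebra_simps)
    then have "p \<in> ?P q" by (simp only: of_int_less_iff) auto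
    moreover have "q \<in> ?Q" using qp M by (simp add: le_floor_iff field_simps)
    moreover have "\<alpha> \<in> I q p"
      using d qp(1) by (auto simp: I_def field_simps abs_less_iff)
    ultimately show "\<alpha> \<in> (\<Union>q\<in>?Q. \<Union>p\<in>?P q. I q p)" by blast
  qed
  have I: "measure lborel (I q p) \<le> 2 * (\<delta> / M) / of_int q" "I q p \<in> fmeasurable lborel" if "q \<ge> 1" for q p
  proof -
    have "(of_int p - \<delta> / M) / of_int q \<le> (of_int p + \<delta> / M) / of_int q"
      using that assms M by (intro divide_right_mono) auto
    then show "measure lborel (I q p) \<le> 2 * (\<delta> / M) / of_int q"
      unfolding I_def by (simp add: diff_divide_distrib add_divide_distrib)
    show "I q p \<in> fmeasurable lborel" unfolding I_def by (simp add: fmeasurable_def emeasure_lborel_Icc_eq)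
  qed
  have "measure lborel (too_approximable N \<delta> M \<inter> {of_int k..of_int k + 1})
      \<le> measure lborel (\<Union>q\<in>?Q. \<Union>p\<in>?P q. I q p)"
    using open_too_approximable I(2) by (intro measure_mono_fmeasurable[OF cover] fmeasurable.finite_UN) auto
  also have "\<dots> \<le> (\<Sum>q\<in>?Q. measure lborel (\<Union>p\<in>?P q. I q p))"
    by (intro measure_UNION_le) (auto simp: I_def)
  also have "\<dots> \<le> (\<Sum>q\<in>?Q. 4 * (\<delta> / M))"
  proof (rule sum_mono)
    fix q assume q: "q \<in> ?Q"
    have "measure lborel (\<Union>p\<in>?P q. I q p) \<le> (\<Sum>p\<in>?P q. measure lborel (I q p))"
      by (intro measure_UNION_le) (auto simp: I_def)
    also have "\<dots> \<le> (\<Sum>p\<in>?P q. 2 * (\<delta> / M) / of_int q)"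
      using q I(1) by (intro sum_mono) auto
    also have "\<dots> = (of_int q + 1) / of_int q * (2 * (\<delta> / M))"
      using q by simp
    also have "\<dots> \<le> 2 * (2 * (\<delta> / M))"
      using q assms M by (intro mult_right_mono) (auto simp: field_simps)
    finally show "measure lborel (\<Union>p\<in>?P q. I q p) \<le> 4 * (\<delta> / M)" by simp
  qed
  also have "\<dots> = of_int \<lfloor>N / M\<rfloor> * (4 * (\<delta> / M))"
    using assms M by simp
  also have "\<dots> \<le> N / M * (4 * (\<delta> / M))"
    using assms M by (intro mult_right_mono) auto
  finally show ?thesis by (simp add: power2_eq_square mult_ac)
qed

text \<open>
  The base \<open>3/2\<close> could be any number strictly between \<open>\<surd>2\<close> and \<open>2\<close>: above \<open>\<surd>2\<close> the measures of the
  layers decay geometrically in \<open>i\<close>, and below \<open>2\<close> so do the costs \<open>allowance j i / 2\<^sup>i\<close>. The factor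
  \<open>j + 1\<close> is the largest that a block can afford, and its inverse square is summable.
\<close>
definition allowance :: "nat \<Rightarrow> nat \<Rightarrow> real" where
  "allowance j i = (real j + 1) * (3 / 2) ^ i"

definition exceptional :: "nat \<Rightarrow> real set" where
  "exceptional j = (\<Union>i\<le>j. too_approximable (2 ^ j) (2 ^ i / 2 ^ j) (allowance j i))"

lemma scale_le_allowance:
  assumes "i \<le> j"
  shows "2 ^ i / 2 ^ j \<le> allowance j i"
proof -
  have "(2::real) ^ i / 2 ^ j \<le> 1 * 1" using assms by simp
  also have "\<dots> \<le> (real j + 1) * (3 / 2) ^ i"
    by (intro mult_mono one_le_power) auto
  finally show ?thesis by (simp only: allowance_def mult_1)
qed

lemma measure_exceptional_le:
  fixes k :: int
  shows "measure lborel (exceptional j \<inter> {of_int k..of_int k + 1}) \<le> 36 / (real j + 1)\<^sup>2"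
proof -
  have "measure lborel (exceptional j \<inter> {of_int k..of_int k + 1})
     \<le> (\<Sum>i\<le>j. measure lborel (too_approximable (2 ^ j) (2 ^ i / 2 ^ j) (allowance j i) \<inter> {of_int k..of_int k + 1}))"
    unfolding exceptional_def UN_simps(4)[symmetric]
    using open_too_approximable by (intro measure_UNION_le) auto
  also have "\<dots> \<le> (\<Sum>i\<le>j. 4 / (real j + 1)\<^sup>2 * (8 / 9) ^ i)"
  proof (rule sum_mono)
    fix i assume "i \<in> {..j}"
    then have "measure lborel (too_approximable (2 ^ j) (2 ^ i / 2 ^ j) (allowance j i) \<inter> {of_int k..of_int k + 1})
       \<le> 4 * 2 ^ j * (2 ^ i / 2 ^ j) / (allowance j i)\<^sup>2"
      by (intro measure_too_approximable_le scale_le_allowance) auto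
    also have "\<dots> = 4 / (real j + 1)\<^sup>2 * (2 ^ i / ((3 / 2) ^ i)\<^sup>2)"
      by (simp add: allowance_def power_mult_distrib)
    also have "2 ^ i / ((3 / 2) ^ i)\<^sup>2 = ((8 :: real) / 9) ^ i"
      unfolding power2_eq_square power_mult_distrib[symmetric] power_divide[symmetric] by simp
    finally show "measure lborel (too_approximable (2 ^ j) (2 ^ i / 2 ^ j) (allowance j i) \<inter> {of_int k..of_int k + 1})
        \<le> 4 / (real j + 1)\<^sup>2 * (8 / 9) ^ i" .
  qed
  also have "\<dots> = 4 / (real j + 1)\<^sup>2 * (\<Sum>i\<le>j. (8 / 9) ^ i)"
    by (simp add: sum_distrib_left)
  also have "(\<Sum>i\<le>j. ((8::real) / 9) ^ i) \<le> 9"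
    by (simp add: sum_gp_strict lessThan_Suc_atMost[symmetric])
  finally show ?thesis by (simp add: mult_left_mono divide_right_mono)
qed

text \<open>
  The Borel-Cantelli lemma needs sets of finite measure, so it is applied in each unit interval
  \<open>[k, k + 1]\<close>; countably many null sets are then discarded.
\<close>
lemma AE_eventually_not_exceptional:
  "AE \<alpha> in lborel. \<forall>\<^sub>F j in sequentially. \<alpha> \<notin> exceptional j"
proof -
  have "AE \<alpha> in lborel. \<forall>\<^sub>F j in sequentially.
          \<alpha> \<in> space lborel - exceptional j \<inter> {of_int k..of_int k + 1}" for k :: int
  proof (rule borel_cantelli_AE1)
    have "open (exceptional j)" for j
      unfolding exceptional_def using open_too_approximable by auto
    then show meas: "exceptional j \<inter> {of_int k..of_int k + 1} \<in> sets lborel" for j by auto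
    have "emeasure lborel (exceptional j \<inter> {of_int k..of_int k + 1}) \<le> emeasure lborel {real_of_int k..of_int k + 1}" for j
      by (intro emeasure_mono) auto
    then show "emeasure lborel (exceptional j \<inter> {of_int k..of_int k + 1}) < \<infinity>" for j
      by (rule order.strict_trans1) auto
    have "summable (\<lambda>j. 36 * inverse (real (Suc j) ^ 2))"
      using inverse_power_summable[of 2, where 'a=real] by (intro summable_mult) (subst summable_Suc_iff, auto)
    then show "summable (\<lambda>j. measure lborel (exceptional j \<inter> {of_int k..of_int k + 1}))"
      by (rule summable_comparison_test')
        (use measure_exceptional_le in \<open>auto simp: field_simps\<close>)
  qed
  then have "AE \<alpha> in lborel. \<forall>k :: int. \<forall>\<^sub>F j in sequentially.
          \<alpha> \<in> space lborel - exceptional j \<inter> {of_int k..of_int k + 1}"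
    by (simp add: AE_all_countable)
  then show ?thesis
  proof eventually_elim
    case (elim \<alpha>)
    have "of_int \<lfloor>\<alpha>\<rfloor> \<le> \<alpha>" "\<alpha> \<le> of_int \<lfloor>\<alpha>\<rfloor> + 1" by linarith+
    with elim[rule_format, of "\<lfloor>\<alpha>\<rfloor>"] show ?case
      by (auto elim!: eventually_mono)
  qed
qed

section \<open>Summing over dyadic blocks\<close>

text \<open>
  It suffices that the least \<open>i\<close> with \<open>d \<le> 2\<^sup>i/2\<^sup>j\<close> appears in the sum. Listing all larger \<open>i\<close> as well
  costs only a constant factor, since the weights are geometric, and turns a sum over \<open>n\<close> into
  counts of the form bounded above.
\<close>
lemma reciprocal_le_layers:
  fixes d c :: real
  assumes "2 ^ j \<le> n" "c > 0" "real n * d \<ge> c" "d \<le> 1"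
  shows "1 / (real n * d) \<le> (\<Sum>i\<le>j. (1 / c + 2) * (1 / 2) ^ i * of_bool (d \<le> 2 ^ i / 2 ^ j))"
proof -
  have n: "real n \<ge> 2 ^ j" using assms(1) by (metis of_nat_le_iff of_nat_numeral of_nat_power)
  have d: "d > 0"
    using assms by (metis less_le_trans of_nat_0_le_iff order_less_imp_not_less zero_less_mult_pos linorder_not_le mult_nonneg_nonpos)
  define i where "i = (LEAST i. d \<le> 2 ^ i / 2 ^ j)"
  have ex: "d \<le> 2 ^ j / 2 ^ j" using assms(4) by simp
  have i: "d \<le> 2 ^ i / 2 ^ j" unfolding i_def by (rule LeastI[of _ j]) (rule ex)
  have ij: "i \<le> j" unfolding i_def by (rule Least_le) (rule ex)
  have "1 / (real n * d) \<le> (1 / c + 2) * (1 / 2) ^ i"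
  proof (cases i)
    case 0
    have "1 / (real n * d) \<le> 1 / c" using assms by (intro divide_left_mono) auto
    then show ?thesis using 0 by simp
  next
    case (Suc i')
    then have "\<not> d \<le> 2 ^ i' / 2 ^ j" unfolding i_def by (intro not_less_Least) simp
    then have "2 ^ j * (2 ^ i' / 2 ^ j) \<le> real n * d"
      using n by (intro mult_mono) auto
    then have "1 / (real n * d) \<le> 1 / 2 ^ i'"
      using d n by (intro divide_left_mono) (auto intro!: mult_pos_pos less_le_trans[OF _ n])
    also have "\<dots> = 2 * (1 / 2) ^ i" using Suc by (simp add: power_divide)
    also have "\<dots> \<le> (1 / c + 2) * (1 / 2) ^ i" using assms by (intro mult_right_mono) auto
    finally show ?thesis .
  qed
  also have "\<dots> = (1 / c + 2) * (1 / 2) ^ i * of_bool (d \<le> 2 ^ i / 2 ^ j)" using i by simp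
  also have "\<dots> \<le> (\<Sum>i\<le>j. (1 / c + 2) * (1 / 2) ^ i * of_bool (d \<le> 2 ^ i / 2 ^ j))"
    using ij assms by (intro member_le_sum[of i "{..j}"]) auto
  finally show ?thesis .
qed

text \<open>
  Exchanging the order of summation, layer \<open>i\<close> carries weight \<open>2\<^sup>-\<^sup>i\<close> and at most
  \<open>5 \<cdot> 2\<^sup>i + 7 (j + 1) (3/2)\<^sup>i\<close> indices. The first part gives \<open>5\<close> for each of the \<open>j + 1\<close> layers, the
  second a geometric series of ratio \<open>3/4\<close>, whose sum is at most \<open>4\<close>, so the total factor is \<open>5 + 7 \<cdot> 4 = 33\<close>.
\<close>
lemma dyadic_block_sum_le:
  assumes "\<alpha> \<notin> exceptional j" "c > 0"
  shows "(\<Sum>n | n \<in> {2 ^ j..<2 ^ Suc j} \<and> real n * dist_int (real n * \<alpha> - \<gamma>) \<ge> c.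
             1 / (real n * dist_int (real n * \<alpha> - \<gamma>))) \<le> 33 * (1 / c + 2) * (real j + 1)"
proof -
  define d where "d n = dist_int (real n * \<alpha> - \<gamma>)" for n
  let ?B = "{2 ^ j..<2 ^ Suc j} :: nat set"
  have "(\<Sum>n | n \<in> ?B \<and> real n * d n \<ge> c. 1 / (real n * d n))
     \<le> (\<Sum>n | n \<in> ?B \<and> real n * d n \<ge> c. \<Sum>i\<le>j. (1 / c + 2) * (1 / 2) ^ i * of_bool (d n \<le> 2 ^ i / 2 ^ j))"
    using assms(2) dist_int_le_half
    by (intro sum_mono reciprocal_le_layers) (auto simp: d_def intro: order_trans[of _ "1/2"])
  also have "\<dots> \<le> (\<Sum>n\<in>?B. \<Sum>i\<le>j. (1 / c + 2) * (1 / 2) ^ i * of_bool (d n \<le> 2 ^ i / 2 ^ j))"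
    using assms(2) by (intro sum_mono2 sum_nonneg) auto
  also have "\<dots> = (\<Sum>i\<le>j. (1 / c + 2) * (1 / 2) ^ i * (\<Sum>n\<in>?B. of_bool (d n \<le> 2 ^ i / 2 ^ j)))"
    unfolding sum_distrib_left by (rule sum.swap)
  also have "\<dots> = (\<Sum>i\<le>j. (1 / c + 2) * (1 / 2) ^ i * real (card {n \<in> ?B. d n \<le> 2 ^ i / 2 ^ j}))"
  proof -
    have "(\<Sum>n\<in>?B. of_bool (P n)) = real (card {n \<in> ?B. P n})" for P
      by (simp add: of_bool_def sum.If_cases Int_def)
    then show ?thesis by (simp only:)
  qed
  also have "\<dots> \<le> (\<Sum>i\<le>j. (1 / c + 2) * (5 + 7 * (real j + 1) * (3 / 4) ^ i))"
  proof (rule sum_mono)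
    fix i assume i: "i \<in> {..j}"
    have tg: "\<alpha> \<notin> too_approximable (real (2 ^ j)) (2 ^ i / 2 ^ j) (allowance j i)"
      using assms(1) i by (auto simp: exceptional_def)
    have "real (card {n \<in> {2 ^ j..<2 ^ j + 2 ^ j}. d n \<le> 2 ^ i / 2 ^ j})
        \<le> 2 * real (2 ^ j) * (2 ^ i / 2 ^ j) + 7 * allowance j i + 3"
      unfolding d_def using i by (intro card_near_le_if_not_too_approximable tg scale_le_allowance) auto
    also have "\<dots> \<le> 5 * 2 ^ i + 7 * allowance j i" by simp
    finally have "real (card {n \<in> ?B. d n \<le> 2 ^ i / 2 ^ j}) \<le> 5 * 2 ^ i + 7 * allowance j i"
      by (simp add: mult_2)
    then have "(1 / 2) ^ i * real (card {n \<in> ?B. d n \<le> 2 ^ i / 2 ^ j}) \<le> (1 / 2) ^ i * (5 * 2 ^ i + 7 * allowance j i)"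
      by (intro mult_left_mono) auto
    also have "\<dots> = 5 * (1 / 2 * 2) ^ i + 7 * (real j + 1) * (1 / 2 * (3 / 2)) ^ i"
      unfolding power_mult_distrib allowance_def by (simp add: algebra_simps)
    finally show "(1 / c + 2) * (1 / 2) ^ i * real (card {n \<in> ?B. d n \<le> 2 ^ i / 2 ^ j})
        \<le> (1 / c + 2) * (5 + 7 * (real j + 1) * (3 / 4) ^ i)"
      using assms(2) unfolding mult.assoc by (intro mult_left_mono) auto
  qed
  also have "\<dots> = (1 / c + 2) * (5 * (real j + 1) + 7 * (real j + 1) * (\<Sum>i\<le>j. (3 / 4) ^ i))"
    by (simp add: sum_distrib_left[symmetric] sum.distrib)
  also have "\<dots> \<le> (1 / c + 2) * (5 * (real j + 1) + 7 * (real j + 1) * 4)"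
    using assms(2) by (intro mult_left_mono add_left_mono)
      (simp_all add: sum_gp_strict lessThan_Suc_atMost[symmetric])
  also have "\<dots> \<le> 33 * (1 / c + 2) * (real j + 1)"
    using assms(2) by (simp add: field_simps)
  finally show ?thesis by (simp add: d_def)
qed

text \<open>
  In the blocks below \<open>j0\<close>, where \<open>\<alpha>\<close> may be exceptional, the cutoff alone bounds each of the fewer
  than \<open>2 ^ j0\<close> terms by \<open>1/c\<close>.
\<close>
lemma dyadic_partial_sum_le:
  assumes "\<And>j. j \<ge> j0 \<Longrightarrow> \<alpha> \<notin> exceptional j" "c > 0"
  shows "(\<Sum>n | n < 2 ^ J \<and> real n * dist_int (real n * \<alpha> - \<gamma>) \<ge> c.
             1 / (real n * dist_int (real n * \<alpha> - \<gamma>)))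
          \<le> 2 ^ j0 / c + 33 * (1 / c + 2) * (real J)\<^sup>2"
proof (induction J)
  case 0
  then show ?case using assms(2) by auto
next
  case (Suc J)
  define f where "f n = 1 / (real n * dist_int (real n * \<alpha> - \<gamma>))" for n
  let ?ok = "\<lambda>n. real n * dist_int (real n * \<alpha> - \<gamma>) \<ge> c"
  have IH: "(\<Sum>n | n < 2 ^ J \<and> ?ok n. f n) \<le> 2 ^ j0 / c + 33 * (1 / c + 2) * (real J)\<^sup>2"
    using Suc by (simp add: f_def)
  have "(\<Sum>n | n < 2 ^ Suc J \<and> ?ok n. f n) \<le> 2 ^ j0 / c + 33 * (1 / c + 2) * (real (Suc J))\<^sup>2"
  proof (cases "Suc J \<le> j0")
    case True
    have "(\<Sum>n | n < 2 ^ Suc J \<and> ?ok n. f n) \<le> of_nat (card {n. n < 2 ^ Suc J \<and> ?ok n}) * (1 / c)"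
      using assms(2) unfolding f_def by (intro sum_bounded_above divide_left_mono) auto
    also have "\<dots> \<le> of_nat (card {..<2 ^ Suc J :: nat}) * (1 / c)"
      using assms(2) by (intro mult_right_mono of_nat_mono card_mono) auto
    also have "\<dots> \<le> 2 ^ j0 * (1 / c)"
      using assms(2) power_increasing[OF True, of "2::real"] by (intro mult_right_mono) auto
    also have "\<dots> \<le> 2 ^ j0 / c + 33 * (1 / c + 2) * (real (Suc J))\<^sup>2"
      using assms(2) by simp
    finally show ?thesis .
  next
    case False
    let ?B = "{n. n \<in> {2 ^ J..<2 ^ Suc J} \<and> ?ok n}"
    have split: "{n. n < 2 ^ Suc J \<and> ?ok n} = {n. n < 2 ^ J \<and> ?ok n} \<union> ?B"
      by auto
    have "sum f {n. n < 2 ^ Suc J \<and> ?ok n} = sum f {n. n < 2 ^ J \<and> ?ok n} + sum f ?B"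
      unfolding split by (rule sum.union_disjoint) auto
    also have "(\<Sum>n\<in>?B. f n) \<le> 33 * (1 / c + 2) * (real J + 1)"
      unfolding f_def using False assms by (intro dyadic_block_sum_le) auto
    also note IH
    also have "2 ^ j0 / c + 33 * (1 / c + 2) * (real J)\<^sup>2 + 33 * (1 / c + 2) * (real J + 1)
        = 2 ^ j0 / c + 33 * (1 / c + 2) * ((real J)\<^sup>2 + (real J + 1))"
      by (simp add: distrib_left)
    also have "\<dots> \<le> 2 ^ j0 / c + 33 * (1 / c + 2) * (real (Suc J))\<^sup>2"
      using assms(2) by (intro add_left_mono mult_left_mono) (auto simp: power2_eq_square algebra_simps)
    finally show ?thesis by simp
  qed
  then show ?case by (simp only: f_def)
qed

text \<open>
  From \<open>N \<ge> 3 \<ge> e\<close> we get \<open>ln N \<ge> 1\<close>, which lets the squared logarithm absorb the constant part of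
  the bound; the last block index \<open>J\<close> satisfies \<open>J + 1 \<le> 4 ln N\<close>, and \<open>528 = 33 \<cdot> 4\<^sup>2\<close>.
\<close>
lemma sum_reciprocals_le:
  assumes "\<And>j. j \<ge> j0 \<Longrightarrow> \<alpha> \<notin> exceptional j" "c > 0" "N \<ge> 3"
  shows "(\<Sum>n | 1 \<le> n \<and> n \<le> N \<and> real n * dist_int (real n * \<alpha> - \<gamma>) \<ge> c.
             1 / (real n * dist_int (real n * \<alpha> - \<gamma>)))
          \<le> (2 ^ j0 / c + 528 * (1 / c + 2)) * (ln (real N))\<^sup>2"
proof -
  obtain J where J: "2 ^ J \<le> N" "N < 2 ^ (J + 1)"
    using ex_power_ivl1[of 2 N] assms(3) by auto
  have lnN: "1 \<le> ln (real N)"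
    using exp_le assms(3) by (subst ln_ge_iff) auto
  have "real J * (1 / 2) \<le> real J * ln 2"
    using ln2_ge_two_thirds by (intro mult_left_mono) auto
  also have "\<dots> = ln (2 ^ J)" by (simp add: ln_realpow)
  also have "\<dots> \<le> ln (real N)"
    using J(1) assms(3) by (subst ln_le_cancel_iff) auto
  finally have J': "real (J + 1) \<le> 4 * ln (real N)" using lnN by simp
  have "(\<Sum>n | 1 \<le> n \<and> n \<le> N \<and> real n * dist_int (real n * \<alpha> - \<gamma>) \<ge> c.
             1 / (real n * dist_int (real n * \<alpha> - \<gamma>)))
      \<le> (\<Sum>n | n < 2 ^ (J + 1) \<and> real n * dist_int (real n * \<alpha> - \<gamma>) \<ge> c.
             1 / (real n * dist_int (real n * \<alpha> - \<gamma>)))"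
    using J(2) assms(2) by (intro sum_mono2) auto
  also have "\<dots> \<le> 2 ^ j0 / c + 33 * (1 / c + 2) * (real (J + 1))\<^sup>2"
    using assms by (intro dyadic_partial_sum_le) auto
  also have "\<dots> \<le> 2 ^ j0 / c * (ln (real N))\<^sup>2 + 33 * (1 / c + 2) * (4 * ln (real N))\<^sup>2"
  proof (rule add_mono)
    have "2 ^ j0 / c * 1 \<le> 2 ^ j0 / c * (ln (real N))\<^sup>2"
      using lnN assms(2) by (intro mult_left_mono one_le_power) auto
    then show "2 ^ j0 / c \<le> 2 ^ j0 / c * (ln (real N))\<^sup>2" by simp
    show "33 * (1 / c + 2) * (real (J + 1))\<^sup>2 \<le> 33 * (1 / c + 2) * (4 * ln (real N))\<^sup>2"
      using J' assms(2) by (intro mult_left_mono power_mono) auto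
  qed
  also have "\<dots> = (2 ^ j0 / c + 528 * (1 / c + 2)) * (ln (real N))\<^sup>2"
    by (simp add: algebra_simps power_mult_distrib)
  finally show ?thesis .
qed

theorem theorem1p6:
  shows "\<exists>A :: real set. - A \<in> null_sets lebesgue \<and>
    (\<forall>\<alpha>\<in>A. \<forall>\<gamma> :: real. \<forall>c :: real. c > 0 \<longrightarrow>
      (\<exists>C :: real. C > 0 \<and>
        (\<forall>\<^sub>F N :: nat in sequentially.
          (\<Sum>n | 1 \<le> n \<and> n \<le> N \<and> real n * dist_int (real n * \<alpha> - \<gamma>) \<ge> c.
             1 / (real n * dist_int (real n * \<alpha> - \<gamma>)))
          \<le> C * (ln (real N))\<^sup>2)))"
proof (intro exI[of _ "{\<alpha>. \<forall>\<^sub>F j in sequentially. \<alpha> \<notin> exceptional j}"] conjI ballI allI impI)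
  show "- {\<alpha>. \<forall>\<^sub>F j in sequentially. \<alpha> \<notin> exceptional j} \<in> null_sets lebesgue"
    using AE_eventually_not_exceptional
    by (auto simp: eventually_ae_filter Compl_eq intro: null_sets_completion_subset null_sets_completionI)
next
  fix \<alpha> \<gamma> c :: real
  assume "\<alpha> \<in> {\<alpha>. \<forall>\<^sub>F j in sequentially. \<alpha> \<notin> exceptional j}" and c: "c > 0"
  then obtain j0 where j0: "\<And>j. j \<ge> j0 \<Longrightarrow> \<alpha> \<notin> exceptional j"
    by (auto simp: eventually_sequentially)
  have "2 ^ j0 / c + 528 * (1 / c + 2) > 0" using c by (intro add_pos_pos mult_pos_pos divide_pos_pos) auto
  moreover have "\<forall>\<^sub>F N :: nat in sequentially.
          (\<Sum>n | 1 \<le> n \<and> n \<le> N \<and> real n * dist_int (real n * \<alpha> - \<gamma>) \<ge> c.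
             1 / (real n * dist_int (real n * \<alpha> - \<gamma>)))
          \<le> (2 ^ j0 / c + 528 * (1 / c + 2)) * (ln (real N))\<^sup>2"
    using eventually_ge_at_top[of 3] by eventually_elim (rule sum_reciprocals_le[OF j0 c])
  ultimately show "\<exists>C :: real. C > 0 \<and>
        (\<forall>\<^sub>F N :: nat in sequentially.
          (\<Sum>n | 1 \<le> n \<and> n \<le> N \<and> real n * dist_int (real n * \<alpha> - \<gamma>) \<ge> c.
             1 / (real n * dist_int (real n * \<alpha> - \<gamma>)))
          \<le> C * (ln (real N))\<^sup>2)" by blast
qed

end
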